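(* Let $G:\mathbb{R}^n\to\mathbb{R}^n$ and let $F(\mathbf{s})=G(\mathbf{s})-\mathbf{s}$ satisfy the Assumption stated in the context, with open convex set $E$, zero $\mathbf{s}^*\in E$, invertible Jacobian $J=F'(\mathbf{s}^* )$ and constants $L,\kappa,\rho$. Fix an integer $m\ge 1$ and a real $\tau>1$. Then for all $q\in(0,1)$ there exist $\delta=\delta(q,\alpha)>0$ and $\varepsilon=\varepsilon(q,\alpha)>0$, where $\alpha=\alpha(\tau,m,C)$ is a constant determined by $\tau$, $m$ and $C=\|J^{-1}\|L\rho$ (the data $F,E,\mathbf{s}^*,L,\rho,\kappa$ being fixed; $\delta$ and $\varepsilon$ do not depend on $\beta$ or $\mathbf{s}_0$), such that the following holds. For every $\beta\in\mathbb{R}$ and $\mathbf{s}_0\in\mathbb{R}^n$, if $\mathbf{s}_0,\mathbf{s}_1,\ldots$ are the iterates produced by the Stabilized Anderson Acceleration algorithm (described in the context) with parameters $m,\beta,\tau$ and starting point $\mathbf{s}_0$, and if $$\|-\beta I-J^{-1}\|\le\delta\quad\text{and}\quad \|\mathbf{s}_0-\mathbf{s}^*\|\le\varepsilon,$$ then $$\mathbf{s}_{j+1}\in E\quad\text{and}\quad \|\mathbf{s}_{j+1}-\mathbf{s}^*\|\le q\,\|\mathbf{s}_j-\mathbf{s}^*\|$$ for all $j\in\mathbb{N}=\{0,1,2,\ldots\}$.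
   Context: Norms are the Euclidean norm on $\mathbb{R}^n$ and the induced operator norm on matrices. $I$ is the identity matrix. Assumption. $F:\mathbb{R}^n\to\mathbb{R}^n$ is differentiable in an open convex set $E\subseteq\mathbb{R}^n$ and there exists $\mathbf{s}^*\in E$ with $F(\mathbf{s}^* )=\mathbf{0}$. Moreover $J=F'(\mathbf{s}^* )$ is invertible and $\|F'(\mathbf{s})-F'(\mathbf{s}^* )\|\le L\|\mathbf{s}-\mathbf{s}^*\|$ for all $\mathbf{s}\in E$. This implies that $\|F(\mathbf{u})-F(\mathbf{v})-J(\mathbf{u}-\mathbf{v})\|\le L\|\mathbf{u}-\mathbf{v}\|\max\{\|\mathbf{u}-\mathbf{s}^*\|,\|\mathbf{v}-\mathbf{s}^*\|\}$ for all $\mathbf{u},\mathbf{v}\in E$, and that there exist $\kappa>0$ and $\rho>0$ such that $U_\kappa(\mathbf{s}^* )=\{\mathbf{u}\in\mathbb{R}^n:\|\mathbf{u}-\mathbf{s}^*\|\le\kappa\}\subseteq E$ and $\frac1\rho\|\mathbf{u}-\mathbf{v}\|\le\|F(\mathbf{u})-F(\mathbf{v})\|\le\rho\|\mathbf{u}-\mathbf{v}\|$ for all $\mathbf{u},\mathbf{v}\in U_\kappa(\mathbf{s}^* )$. The constants $\kappa,\rho$ are fixed in this way. Stabilized Anderson Acceleration. Input: an integer $m\ge1$, $\beta\in\mathbb{R}$, $\mathbf{s}_0\in\mathbb{R}^n$, $\tau>1$. Write $\mathbf{f}_j=F(\mathbf{s}_j)=G(\mathbf{s}_j)-\mathbf{s}_j$,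 $\Delta\mathbf{s}_i=\mathbf{s}_{i+1}-\mathbf{s}_i$, $\Delta\mathbf{f}_i=\mathbf{f}_{i+1}-\mathbf{f}_i$. Set $\mathbf{s}_1=\mathbf{s}_0+\beta\mathbf{f}_0$. For $j=1,2,\ldots$: 1. Set $m_j=\min(m,j)$ and compute $\mathbf{f}_j$. 2. Set $\widehat{\mathbf{f}}_{j-m_j}=\Delta\mathbf{f}_{j-m_j}$ and $P_{j-m_j}=\widehat{\mathbf{f}}_{j-m_j}\widehat{\mathbf{f}}_{j-m_j}^T/(\widehat{\mathbf{f}}_{j-m_j}^T\widehat{\mathbf{f}}_{j-m_j})$. 3. For $d=j-m_j+1,\ldots,j-1$: set $Q_{j-m_j}^{d-1}=\sum_{i=j-m_j}^{d-1}P_i$ and $\widehat{\mathbf{f}}_d=(I-Q_{j-m_j}^{d-1})\Delta\mathbf{f}_d$. If $\tau\|\widehat{\mathbf{f}}_d\|\ge\|\Delta\mathbf{f}_d\|$, set $P_d=\widehat{\mathbf{f}}_d\widehat{\mathbf{f}}_d^T/(\widehat{\mathbf{f}}_d^T\widehat{\mathbf{f}}_d)$; otherwise reset $\widehat{\mathbf{f}}_d=\mathbf{0}$ and set $P_d=0$. 4. Let $\mathcal{I}_j=\{k_1<\cdots<k_{\widehat m_j}\}\subseteq\{j-m_j,\ldots,j-1\}$ be the set of indices $i$ for which $\widehat{\mathbf{f}}_i\neq\mathbf{0}$. Set $\Delta F_{\mathcal{I}_j}=[\Delta\mathbf{f}_{k_1},\ldots,\Delta\mathbf{f}_{k_{\widehat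 m_j}}]$ and $\Delta S_{\mathcal{I}_j}=[\Delta\mathbf{s}_{k_1},\ldots,\Delta\mathbf{s}_{k_{\widehat m_j}}]$. 5. Set $H_j^{(\beta)}=-\beta I+(\Delta S_{\mathcal{I}_j}+\beta\Delta F_{\mathcal{I}_j})\big((\Delta F_{\mathcal{I}_j})^T\Delta F_{\mathcal{I}_j}\big)^{-1}(\Delta F_{\mathcal{I}_j})^T$ and $\mathbf{s}_{j+1}=\mathbf{s}_j-H_j^{(\beta)}\mathbf{f}_j$. Convention: whenever $\widehat{\mathbf{f}}_i=\mathbf{0}$, $P_i$ is taken to be the zero matrix; if $\mathcal{I}_j$ is empty, $H_j^{(\beta)}=-\beta I$. *)

theory Defs
  imports "HOL-Analysis.Analysis" "Jordan_Normal_Form.Gauss_Jordan_Elimination"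
begin

hide_const (open) Matrix.mat
no_notation vec_index (infixl "$" 100)

(* The norm of the type real^'n^'n is the Frobenius norm, hence the explicit operator norm. *)
abbreviation opnorm :: "real^'n^'n \<Rightarrow> real" where
  "opnorm A \<equiv> onorm (\<lambda>x. A *v x)"

abbreviation jac :: "(real^'n \<Rightarrow> real^'n) \<Rightarrow> real^'n \<Rightarrow> real^'n^'n" where
  "jac F s \<equiv> jacobian F (at s)"

definition newton_assumption ::
    "(real^'n \<Rightarrow> real^'n) \<Rightarrow> (real^'n) set \<Rightarrow> real^'n \<Rightarrow> real \<Rightarrow> bool" where
  "newton_assumption F E sstar L \<longleftrightarrow>
     open E \<and> convex E \<and> (\<forall>s\<in>E. F differentiable (at s)) \<and>
     sstar \<in> E \<and> F sstar = 0 \<and> invertible (jac F sstar) \<and>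
     (\<forall>s\<in>E. opnorm (jac F s - jac F sstar) \<le> L * norm (s - sstar))"

definition local_bilipschitz ::
    "(real^'n \<Rightarrow> real^'n) \<Rightarrow> (real^'n) set \<Rightarrow> real^'n \<Rightarrow> real \<Rightarrow> real \<Rightarrow> bool" where
  "local_bilipschitz F E sstar \<kappa> \<rho> \<longleftrightarrow>
     \<kappa> > 0 \<and> \<rho> > 0 \<and> cball sstar \<kappa> \<subseteq> E \<and>
     (\<forall>u\<in>cball sstar \<kappa>. \<forall>v\<in>cball sstar \<kappa>.
        1 / \<rho> * norm (u - v) \<le> norm (F u - F v) \<and> norm (F u - F v) \<le> \<rho> * norm (u - v))"

definition proj_mat :: "real^'n \<Rightarrow> real^'n^'n" where
  "proj_mat v = (if v = 0 then 0 else (\<chi> i k. v $ i * v $ k / (v \<bullet> v)))"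

(* fhat \<tau> df a d is the final (possibly reset) value of the filtered difference number d
   in a window that starts at index a; it is meant for a \<le> d only. *)
fun fhat :: "real \<Rightarrow> (nat \<Rightarrow> real^'n) \<Rightarrow> nat \<Rightarrow> nat \<Rightarrow> real^'n" where
  "fhat \<tau> df a d =
     (if d \<le> a then df a
      else let r = (mat 1 - (\<Sum>i\<in>{a..<d}. proj_mat (fhat \<tau> df a i))) *v df d
           in if \<tau> * norm r \<ge> norm (df d) then r else 0)"

declare fhat.simps [simp del]

definition selected :: "real \<Rightarrow> nat \<Rightarrow> (nat \<Rightarrow> real^'n) \<Rightarrow> nat \<Rightarrow> nat set" where
  "selected \<tau> m df j = {i \<in> {j - min m j ..< j}. fhat \<tau> df (j - min m j) i \<noteq> 0}"

(* The number of columns of the difference matrices varies with the iteration, so these matrices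
   are given by the lists of their columns, and the Gram matrix (of inner products of columns)
   has a size that is not part of its type.  The Gram matrix of the selected columns is
   always invertible, so that mat_inverse does not return None there. *)
definition gram_inv :: "(real^'n) list \<Rightarrow> real Matrix.mat" where
  "gram_inv cs =
     the (mat_inverse (Matrix.mat (length cs) (length cs) (\<lambda>(a, b). cs ! a \<bullet> cs ! b)))"

(* Entrywise form of  - \<beta> I + (S + \<beta> Y) (Y^T Y)^{-1} Y^T,  where S and Y have the columns
   ss and ys. *)
definition anderson_mat :: "real \<Rightarrow> (real^'n) list \<Rightarrow> (real^'n) list \<Rightarrow> real^'n^'n" where
  "anderson_mat \<beta> ss ys =
     - \<beta> *\<^sub>R mat 1 +
     (\<chi> p q. \<Sum>a<length ys. \<Sum>b<length ys.
        (ss ! a + \<beta> *\<^sub>R ys ! a) $ p * gram_inv ys $$ (a, b) * (ys ! b) $ q)"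

definition anderson_step ::
    "(real^'n \<Rightarrow> real^'n) \<Rightarrow> nat \<Rightarrow> real \<Rightarrow> real \<Rightarrow> nat \<Rightarrow> (nat \<Rightarrow> real^'n) \<Rightarrow> real^'n" where
  "anderson_step F m \<beta> \<tau> j s =
     (let ds = (\<lambda>i. s (Suc i) - s i);
          df = (\<lambda>i. F (s (Suc i)) - F (s i));
          ks = sorted_list_of_set (selected \<tau> m df j);
          H = anderson_mat \<beta> (map ds ks) (map df ks)
      in s j - H *v F (s j))"

definition stabilized_anderson ::
    "(real^'n \<Rightarrow> real^'n) \<Rightarrow> nat \<Rightarrow> real \<Rightarrow> real \<Rightarrow> real^'n \<Rightarrow> (nat \<Rightarrow> real^'n) \<Rightarrow> bool" where
  "stabilized_anderson F m \<beta> \<tau> s0 s \<longleftrightarrow>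
     s 0 = s0 \<and> s 1 = s0 + \<beta> *\<^sub>R F s0 \<and>
     (\<forall>j\<ge>1. s (Suc j) = anderson_step F m \<beta> \<tau> j s)"

lemma fhat_cong:
  "(\<And>i. i \<le> max a d \<Longrightarrow> df i = df' i) \<Longrightarrow> fhat \<tau> df a d = fhat \<tau> df' a d"
proof (induction d rule: less_induct)
  case (less d)
  show ?case
  proof (cases "d \<le> a")
    case True
    then show ?thesis using less.prems[of a] by (simp add: fhat.simps[of _ _ a d])
  next
    case False
    have "(\<Sum>i\<in>{a..<d}. proj_mat (fhat \<tau> df a i)) = (\<Sum>i\<in>{a..<d}. proj_mat (fhat \<tau> df' a i))"
    proof (rule sum.cong)
      fix i assume "i \<in> {a..<d}"
      then show "proj_mat (fhat \<tau> df a i) = proj_mat (fhat \<tau> df' a i)"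
        using less.IH[of i] less.prems by simp
    qed simp
    then show ?thesis
      using less.prems[of d] by (simp add: fhat.simps[of _ _ a d] False)
  qed
qed

lemma anderson_step_cong:
  assumes eq: "\<And>i. i \<le> j \<Longrightarrow> s i = s' i"
  shows "anderson_step F m \<beta> \<tau> j s = anderson_step F m \<beta> \<tau> j s'"
proof -
  let ?df = "\<lambda>s i. F (s (Suc i)) - F (s i)"
  have "fhat \<tau> (?df s) (j - min m j) i = fhat \<tau> (?df s') (j - min m j) i"
    if "i \<in> {j - min m j ..< j}" for i
    using that by (intro fhat_cong) (auto simp: eq)
  then have sel: "selected \<tau> m (?df s) j = selected \<tau> m (?df s') j"
    unfolding selected_def by auto
  have fin: "finite (selected \<tau> m (?df s') j)"
    unfolding selected_def by auto
  have loc: "s i = s' i" "s (Suc i) = s' (Suc i)" if "i \<in> selected \<tau> m (?df s') j" for i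
    using that by (auto simp: selected_def eq)
  show ?thesis
    unfolding anderson_step_def Let_def sel
    by (auto simp: eq fin loc intro!: arg_cong2[of _ _ _ _ "anderson_mat \<beta>"] arg_cong2[of _ _ _ _ "(*v)"])
qed

lemma ex1_stabilized_anderson:
  fixes F :: "real^'n \<Rightarrow> real^'n"
  shows "\<exists>!s. stabilized_anderson F m \<beta> \<tau> s0 s"
proof (rule ex_ex1I)
  define step where "step = (\<lambda>(s :: nat \<Rightarrow> real^'n) j.
    if j = 0 then s0 else if j = 1 then s0 + \<beta> *\<^sub>R F s0 else anderson_step F m \<beta> \<tau> (j - 1) s)"
  have "adm_wf less_than step"
    unfolding adm_wf_def
  proof (intro allI impI)
    fix f g :: "nat \<Rightarrow> real^'n" and j
    assume "\<forall>z. (z, j) \<in> less_than \<longrightarrow> f z = g z"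
    then have "anderson_step F m \<beta> \<tau> (j - 1) f = anderson_step F m \<beta> \<tau> (j - 1) g" if "j \<noteq> 0"
      using that by (intro anderson_step_cong) auto
    then show "step f j = step g j"
      unfolding step_def by auto
  qed
  then have "wfrec less_than step j = step (wfrec less_than step) j" for j
    using fun_cong[OF wfrec_fixpoint[OF wf_less_than]] by blast
  note rec = this
  have "stabilized_anderson F m \<beta> \<tau> s0 (wfrec less_than step)"
    using rec[of 0] rec[of 1] rec[of "Suc _"]
    unfolding stabilized_anderson_def by (auto simp: step_def)
  then show "\<exists>s. stabilized_anderson F m \<beta> \<tau> s0 s"
    by blast
next
  fix s s'
  assume s: "stabilized_anderson F m \<beta> \<tau> s0 s" and s': "stabilized_anderson F m \<beta> \<tau> s0 s'"
  have "s j = s' j" for j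
  proof (induction j rule: less_induct)
    case (less j)
    consider "j = 0" | "j = 1" | i where "j = Suc i" "i \<ge> 1"
      by (metis One_nat_def less_one not0_implies_Suc not_le)
    then show ?case
    proof cases
      case 3
      then show ?thesis
        using s s' anderson_step_cong[of i s s'] less by (auto simp: stabilized_anderson_def)
    qed (use s s' in \<open>auto simp: stabilized_anderson_def\<close>)
  qed
  then show "s = s'" ..
qed

end

theory Submission
  imports Defs "Jordan_Normal_Form.Determinant"
begin

text \<open>
  Write \<open>e\<^sub>j = s\<^sub>j - s\<^sup>*\<close>, \<open>f = F s\<^sub>j\<close> and \<open>K = J\<^sup>-\<^sup>1\<close>, and let \<open>S\<close> and \<open>Y\<close> be the matrices of the
  selected differences of iterates and of values. If \<open>c\<close> denotes the least squares solution of
  \<open>Y c \<approx> f\<close>, the Anderson step is a perturbed Newton step: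

  \<open>e\<^sub>j\<^sub>+\<^sub>1 = (e\<^sub>j - K f) - (-\<beta> I - K) (f - Y c) - (S - K Y) c\<close>.

  The first term is quadratically small in \<open>e\<^sub>j\<close>, by the Lipschitz condition on the derivative at
  \<open>s\<^sup>*\<close>. In the second one \<open>f - Y c\<close> is an orthogonal residual, hence no longer than \<open>f\<close>, and
  \<open>-\<beta> I - K\<close> is small by hypothesis. In the third one each column of \<open>S - K Y\<close> is a linearization
  error, of size \<open>\<parallel>K\<parallel> L \<rho> r\<close> times the length of the corresponding column of \<open>Y\<close> as long as all
  iterates are within \<open>r\<close> of \<open>s\<^sup>*\<close>.

  What remains is to bound \<open>\<Sum>\<^sub>k \<bar>c\<^sub>k\<bar> \<parallel>\<Delta>f\<^sub>k\<parallel>\<close> by a multiple of \<open>\<parallel>f\<parallel>\<close>, and this is the purpose of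
  the stabilization (\<open>selected_coefficients_bound\<close>): the filtered vectors are a Gram-Schmidt
  orthogonalization of the selected columns, and a selected column is at most \<open>\<tau>\<close> times as long as
  its filtered vector. Hence back substitution in the triangular system for \<open>c\<close> loses a factor of at
  most \<open>1 + \<tau>\<close> per column, which gives \<open>(1 + \<tau>)\<^sup>m\<close>. Applied to \<open>f = 0\<close>, the same bound shows that the
  selected columns are linearly independent, so that the Gram matrix is invertible and \<open>c\<close> is indeed
  the least squares solution.

  Altogether one step contracts by the factor
  \<open>\<parallel>K\<parallel> L r + (\<delta> + \<parallel>K\<parallel> L \<rho> (1 + \<tau>)\<^sup>m r) \<rho>\<close> (\<open>anderson_step_contraction\<close>), which becomes at most
  \<open>q\<close> for small \<open>r\<close> and \<open>\<delta>\<close> that depend on \<open>\<tau>\<close> and \<open>m\<close> at most through \<open>\<alpha> = C (1 + \<tau>)\<^sup>m\<close>. As \<open>q < 1\<close>,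
  the iterates stay within \<open>r\<close> of \<open>s\<^sup>*\<close> and the step can be repeated.
\<close>

hide_const (open) Matrix.mat
no_notation vec_index (infixl "$" 100)
no_notation scalar_prod (infix "\<bullet>" 70)

section \<open>Back substitution in a triangular system\<close>

text \<open>
  The hypothesis bounds each unknown of an upper triangular system by the unknowns after it. Adding
  the unknowns from the last to the first, each one multiplies the partial sum (which starts with
  the data \<open>N\<close>) by at most \<open>1 + t\<close>; hence the induction adds elements below the current ones.
\<close>

lemma back_substitution_bound:
  fixes x :: "'a::linorder \<Rightarrow> real"
  assumes "finite I" and "0 \<le> t"
    and "\<And>d. d \<in> I \<Longrightarrow> x d \<le> t * (N + (\<Sum>i\<in>{i\<in>I. d < i}. x i))"
  shows "N + (\<Sum>i\<in>I. x i) \<le> (1 + t) ^ card I * N"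
  using assms(1,3)
proof (induction I rule: finite_linorder_min_induct)
  case empty
  then show ?case by simp
next
  case (insert b A)
  have "{i \<in> insert b A. b < i} = A"
    using insert.hyps by auto
  then have xb: "x b \<le> t * (N + sum x A)"
    using insert.prems[of b] by simp
  have "x d \<le> t * (N + (\<Sum>i\<in>{i\<in>A. d < i}. x i))" if "d \<in> A" for d
  proof -
    have "{i \<in> insert b A. d < i} = {i\<in>A. d < i}"
      using insert.hyps that by auto
    then show ?thesis
      using insert.prems[of d] that by simp
  qed
  then have IH: "N + sum x A \<le> (1 + t) ^ card A * N"
    by (rule insert.IH)
  have "N + sum x (insert b A) = x b + (N + sum x A)"
    using insert.hyps by auto
  also have "\<dots> \<le> (1 + t) * (N + sum x A)"
    using xb by (simp add: algebra_simps)
  also have "\<dots> \<le> (1 + t) * ((1 + t) ^ card A * N)"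
    using IH \<open>0 \<le> t\<close> by (intro mult_left_mono) auto
  also have "\<dots> = (1 + t) ^ card (insert b A) * N"
    using insert.hyps by auto
  finally show ?case .
qed

section \<open>The filtered differences as a Gram-Schmidt process\<close>

lemma proj_mat_mult: "proj_mat v *v x = ((v \<bullet> x) / (v \<bullet> v)) *\<^sub>R v"
proof (cases "v = 0")
  case False
  then show ?thesis
    by (simp add: proj_mat_def Finite_Cartesian_Product.vec_eq_iff matrix_vector_mult_def inner_vec_def[of v x]
        sum_divide_distrib sum_distrib_right sum_distrib_left mult_ac)
qed (simp add: proj_mat_def)

lemma sum_matrix_vector_mult:
  fixes A :: "'i \<Rightarrow> real^'n^'m"
  shows "(\<Sum>i\<in>I. A i) *v x = (\<Sum>i\<in>I. A i *v x)"
  by (induction I rule: infinite_finite_induct) (auto simp: matrix_vector_mult_add_rdistrib)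

lemma fhat_first: "fhat \<tau> df a a = df a"
  by (simp add: fhat.simps[of _ _ a a])

text \<open>
  The value of the filter before the test that may reset it. A vector that was reset earlier
  contributes nothing: its coefficient is a division by zero, hence zero, in accordance with the
  zero matrix that replaces its projection.
\<close>

definition gs_residual :: "real \<Rightarrow> (nat \<Rightarrow> real^'n) \<Rightarrow> nat \<Rightarrow> nat \<Rightarrow> real^'n" where
  "gs_residual \<tau> df a d =
     df d - (\<Sum>i\<in>{a..<d}. ((fhat \<tau> df a i \<bullet> df d) / (fhat \<tau> df a i \<bullet> fhat \<tau> df a i))
        *\<^sub>R fhat \<tau> df a i)"

text \<open>
  At the first index the sum in the residual is empty and the filter is never reset; as \<open>1 < \<tau>\<close>,
  the norm bound of the second case also holds there, so the first index needs no special treatment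
  later on.
\<close>

lemma fhat_cases:
  assumes "a \<le> d" and "1 < \<tau>"
  obtains "fhat \<tau> df a d = 0"
  | "fhat \<tau> df a d = gs_residual \<tau> df a d" "norm (df d) \<le> \<tau> * norm (fhat \<tau> df a d)"
proof (cases "d \<le> a")
  case True
  then have "d = a" using assms by simp
  moreover have "norm (df a) \<le> \<tau> * norm (df a)"
    using assms(2) mult_right_mono[of 1 \<tau> "norm (df a)"] by simp
  ultimately show ?thesis
    using that by (simp add: fhat_first gs_residual_def)
next
  case False
  have eq: "(mat 1 - (\<Sum>i\<in>{a..<d}. proj_mat (fhat \<tau> df a i))) *v df d = gs_residual \<tau> df a d"
    by (simp add: matrix_vector_mult_diff_rdistrib sum_matrix_vector_mult proj_mat_mult
        gs_residual_def)
  show ?thesis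
  proof (cases "norm (df d) \<le> \<tau> * norm (gs_residual \<tau> df a d)")
    case True
    then have "fhat \<tau> df a d = gs_residual \<tau> df a d"
      using False by (simp add: fhat.simps[of _ _ a d] eq)
    then show ?thesis
      using that True by simp
  next
    case f: False
    then have "fhat \<tau> df a d = 0"
      using False by (simp add: fhat.simps[of _ _ a d] eq)
    then show ?thesis
      using that by simp
  qed
qed

lemma fhat_orthogonal_previous:
  assumes "1 < \<tau>" and "a \<le> i" and "i < d"
  shows "fhat \<tau> df a i \<bullet> fhat \<tau> df a d = 0"
  using assms(2,3)
proof (induction d arbitrary: i rule: less_induct)
  case (less d)
  let ?h = "fhat \<tau> df a"
  have orth: "?h i \<bullet> ?h k = 0" if "k \<in> {a..<d} - {i}" for k
    using less.IH[of k i] less.IH[of i k] that less.prems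
    by (cases "i < k") (auto simp: inner_commute)
  have "(\<Sum>k\<in>{a..<d}. ((?h k \<bullet> df d) / (?h k \<bullet> ?h k)) * (?h i \<bullet> ?h k))
      = ((?h i \<bullet> df d) / (?h i \<bullet> ?h i)) * (?h i \<bullet> ?h i)"
    using less.prems orth by (subst sum.remove[of _ i]) auto
  also have "\<dots> = ?h i \<bullet> df d"
    by (cases "?h i = 0") auto
  finally have "?h i \<bullet> gs_residual \<tau> df a d = 0"
    by (simp add: gs_residual_def inner_diff_right inner_sum_right)
  moreover have "a \<le> d"
    using less.prems by simp
  ultimately show ?case
    using assms(1) by (cases rule: fhat_cases[OF \<open>a \<le> d\<close> \<open>1 < \<tau>\<close>, of df]) auto
qed

lemma fhat_orthogonal:
  assumes "1 < \<tau>" "a \<le> i" "a \<le> k" "i \<noteq> k"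
  shows "fhat \<tau> df a i \<bullet> fhat \<tau> df a k = 0"
  using fhat_orthogonal_previous[of \<tau> a i k df] fhat_orthogonal_previous[of \<tau> a k i df] assms
  by (cases "i < k") (auto simp: inner_commute)

text \<open>
  The columns are upper triangular in terms of the filtered vectors: a selected column is its own
  filtered vector plus a combination of earlier ones. For an unselected index this fails, because
  the reset discards the remainder.
\<close>

lemma fhat_inner_selected:
  assumes "1 < \<tau>" "a \<le> i" "fhat \<tau> df a i \<noteq> 0" "i \<le> d"
  shows "fhat \<tau> df a d \<bullet> df i = (if i = d then fhat \<tau> df a d \<bullet> fhat \<tau> df a d else 0)"
proof -
  let ?h = "fhat \<tau> df a"
  have "?h i = gs_residual \<tau> df a i"
    using fhat_cases[OF assms(2,1), of df] assms(3) by metis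
  then have "df i = ?h i + (\<Sum>k\<in>{a..<i}. ((?h k \<bullet> df i) / (?h k \<bullet> ?h k)) *\<^sub>R ?h k)"
    by (simp add: gs_residual_def)
  then have "?h d \<bullet> df i
      = ?h d \<bullet> ?h i + (\<Sum>k\<in>{a..<i}. ((?h k \<bullet> df i) / (?h k \<bullet> ?h k)) * (?h d \<bullet> ?h k))"
    by (metis (no_types, lifting) inner_add_right inner_scaleR_right inner_sum_right sum.cong)
  moreover have "?h d \<bullet> ?h k = 0" if "k \<in> {a..<i}" for k
    using that assms by (intro fhat_orthogonal) auto
  ultimately show ?thesis
    using fhat_orthogonal[of \<tau> a d i df] assms by (simp add: inner_commute)
qed

text \<open>
  Every filtered vector is a combination of selected columns, since reset vectors do not enter
  later residuals. Hence it inherits orthogonality from the selected columns.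
\<close>

lemma fhat_orthogonal_residual:
  assumes "1 < \<tau>" and "a \<le> d" and "d < j"
    and orth: "\<And>i. i \<in> {a..<j} \<Longrightarrow> fhat \<tau> df a i \<noteq> 0 \<Longrightarrow> df i \<bullet> g = 0"
  shows "fhat \<tau> df a d \<bullet> g = 0"
  using assms(2,3)
proof (induction d rule: less_induct)
  case (less d)
  show ?case
  proof (cases "fhat \<tau> df a d = 0")
    case False
    then have "fhat \<tau> df a d = gs_residual \<tau> df a d"
      using fhat_cases[OF less.prems(1) assms(1), of df] by metis
    then show ?thesis
      using less False orth[of d]
      by (simp add: gs_residual_def inner_diff_left inner_sum_left)
  qed simp
qed

text \<open>
  The hypothesis \<open>orth\<close> is the system of normal equations for the coefficients \<open>c\<close>. Taking the inner
  product of the residual with the filtered vector \<open>h\<^sub>d\<close> leaves only the terms from \<open>d\<close> on: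
  \<open>c\<^sub>d \<parallel>h\<^sub>d\<parallel>\<^sup>2 = h\<^sub>d \<bullet> (f - \<Sum>\<^sub>i\<^sub>>\<^sub>d c\<^sub>i \<Delta>f\<^sub>i)\<close>. Since \<open>\<parallel>\<Delta>f\<^sub>d\<parallel> \<le> \<tau> \<parallel>h\<^sub>d\<parallel>\<close> by the selection test, the products
  \<open>\<bar>c\<^sub>d\<bar> \<parallel>\<Delta>f\<^sub>d\<parallel>\<close> satisfy the recursion of \<open>back_substitution_bound\<close>.
\<close>

lemma selected_coefficients_bound:
  assumes "1 < \<tau>" and "I = selected \<tau> m df j"
    and orth: "\<And>i. i \<in> I \<Longrightarrow> df i \<bullet> (f - (\<Sum>k\<in>I. c k *\<^sub>R df k)) = 0"
  shows "(\<Sum>i\<in>I. \<bar>c i\<bar> * norm (df i)) \<le> (1 + \<tau>) ^ m * norm f"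
proof -
  define a where "a = j - min m j"
  let ?h = "fhat \<tau> df a"
  define x where "x i = \<bar>c i\<bar> * norm (df i)" for i
  have I: "I = {i \<in> {a..<j}. ?h i \<noteq> 0}"
    using assms(2) by (simp add: selected_def a_def)
  then have fin: "finite I" by simp
  have "card I \<le> card {a..<j}"
    unfolding I by (intro card_mono) auto
  then have card: "card I \<le> m"
    by (simp add: a_def)
  have "x d \<le> \<tau> * (norm f + (\<Sum>i\<in>{i\<in>I. d < i}. x i))" if d: "d \<in> I" for d
  proof -
    let ?w = "f - (\<Sum>i\<in>{i\<in>I. d < i}. c i *\<^sub>R df i)"
    have d': "a \<le> d" "d < j" "?h d \<noteq> 0"
      using d I by auto
    have split: "(\<Sum>k\<in>I. c k *\<^sub>R df k)
        = (\<Sum>k\<in>{k\<in>I. d < k}. c k *\<^sub>R df k) + (\<Sum>k\<in>{k\<in>I. k \<le> d}. c k *\<^sub>R df k)"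
      using fin by (subst sum.union_disjoint[symmetric]) (auto intro!: sum.cong)
    have "?h d \<bullet> (\<Sum>k\<in>{k\<in>I. k \<le> d}. c k *\<^sub>R df k)
        = (\<Sum>k\<in>{k\<in>I. k \<le> d}. if k = d then c d * (?h d \<bullet> ?h d) else 0)"
      unfolding inner_sum_right
    proof (rule sum.cong[OF refl])
      fix k assume "k \<in> {k\<in>I. k \<le> d}"
      then show "?h d \<bullet> (c k *\<^sub>R df k) = (if k = d then c d * (?h d \<bullet> ?h d) else 0)"
        using I fhat_inner_selected[OF assms(1), of a k df d] by auto
    qed
    also have "\<dots> = c d * (?h d \<bullet> ?h d)"
      using fin d by simp
    finally have low: "?h d \<bullet> (\<Sum>k\<in>{k\<in>I. k \<le> d}. c k *\<^sub>R df k) = c d * (?h d \<bullet> ?h d)" .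
    have "?h d \<bullet> (f - (\<Sum>k\<in>I. c k *\<^sub>R df k)) = 0"
      using orth I d' by (intro fhat_orthogonal_residual[OF assms(1) d'(1,2)]) auto
    then have "c d * (?h d \<bullet> ?h d) = ?h d \<bullet> ?w"
      using low by (simp add: split inner_diff_right inner_add_right)
    then have "\<bar>c d\<bar> * (norm (?h d))\<^sup>2 = \<bar>?h d \<bullet> ?w\<bar>"
      by (metis abs_mult abs_power2 power2_norm_eq_inner)
    also have "\<dots> \<le> norm (?h d) * norm ?w"
      by (rule Cauchy_Schwarz_ineq2)
    finally have "(\<bar>c d\<bar> * norm (?h d)) * norm (?h d) \<le> norm ?w * norm (?h d)"
      by (simp only: power2_eq_square mult.assoc mult.commute[of "norm ?w"])
    then have "\<bar>c d\<bar> * norm (?h d) \<le> norm ?w"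
      using d'(3) by simp
    moreover have "norm ?w \<le> norm f + (\<Sum>i\<in>{i\<in>I. d < i}. x i)"
    proof -
      have "norm (\<Sum>i\<in>{i\<in>I. d < i}. c i *\<^sub>R df i) \<le> (\<Sum>i\<in>{i\<in>I. d < i}. x i)"
        unfolding x_def by (rule order_trans[OF norm_sum]) simp
      then show ?thesis
        using norm_triangle_ineq4[of f "\<Sum>i\<in>{i\<in>I. d < i}. c i *\<^sub>R df i"] by linarith
    qed
    moreover have "x d \<le> \<tau> * (\<bar>c d\<bar> * norm (?h d))"
    proof -
      have "norm (df d) \<le> \<tau> * norm (?h d)"
        using fhat_cases[OF d'(1) assms(1), of df] d'(3) by metis
      then have "\<bar>c d\<bar> * norm (df d) \<le> \<bar>c d\<bar> * (\<tau> * norm (?h d))"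
        by (intro mult_left_mono) auto
      then show ?thesis by (simp add: x_def mult_ac)
    qed
    ultimately show ?thesis
      using assms(1) mult_left_mono[of "\<bar>c d\<bar> * norm (?h d)" _ \<tau>] by (smt (verit))
  qed
  then have "norm f + (\<Sum>i\<in>I. x i) \<le> (1 + \<tau>) ^ card I * norm f"
    using assms(1) by (intro back_substitution_bound[OF fin]) auto
  also have "\<dots> \<le> (1 + \<tau>) ^ m * norm f"
    using card assms(1) by (intro mult_right_mono power_increasing) auto
  finally show ?thesis
    unfolding x_def using norm_ge_zero[of f] by linarith
qed

lemma selected_nonzero:
  assumes "1 < \<tau>" and "i \<in> selected \<tau> m df j"
  shows "df i \<noteq> 0"
proof
  assume z: "df i = 0"
  have i: "j - min m j \<le> i" "fhat \<tau> df (j - min m j) i \<noteq> 0"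
    using assms(2) by (auto simp: selected_def)
  then show False
    using fhat_inner_selected[OF assms(1) i, of i] z by simp
qed

text \<open>
  A vanishing combination of the selected columns solves the normal equations with right-hand side
  zero, so the coefficient bound forces all its coefficients to vanish.
\<close>

lemma selected_independent:
  assumes "1 < \<tau>" and "I = selected \<tau> m df j"
    and "(\<Sum>k\<in>I. c k *\<^sub>R df k) = 0" and "i \<in> I"
  shows "c i = 0"
proof -
  have fin: "finite I" using assms(2) by (simp add: selected_def)
  have "(\<Sum>i\<in>I. \<bar>c i\<bar> * norm (df i)) \<le> (1 + \<tau>) ^ m * norm (0 :: real^'a)"
    using assms by (intro selected_coefficients_bound[OF assms(1,2)]) auto
  then have "(\<Sum>i\<in>I. \<bar>c i\<bar> * norm (df i)) = 0"
    by (intro antisym sum_nonneg) auto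
  then have "\<bar>c i\<bar> * norm (df i) = 0"
    using fin assms(4) by (subst (asm) sum_nonneg_eq_0_iff) auto
  then show ?thesis
    using selected_nonzero[OF assms(1)] assms(2,4) by auto
qed

section \<open>The Anderson matrix and least squares\<close>

text \<open>
  If the Gram matrix sends \<open>v\<close> to zero, then \<open>\<Sum>\<^sub>k v\<^sub>k y\<^sub>k\<close> is orthogonal to every column, hence to
  itself; so for independent columns the Gram matrix has a trivial kernel and the Gauss-Jordan
  algorithm succeeds.
\<close>

lemma gram_inv_right_inverse:
  fixes ys :: "(real^'n) list"
  assumes indep: "\<And>c. (\<Sum>a<length ys. c a *\<^sub>R ys ! a) = 0 \<Longrightarrow> \<forall>a<length ys. c a = 0"
    and "a < length ys" and "b < length ys"
  shows "(\<Sum>k<length ys. (ys ! a \<bullet> ys ! k) * gram_inv ys $$ (k, b)) = (if a = b then 1 else 0)"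
proof -
  define n where "n = length ys"
  define A where "A = Matrix.mat n n (\<lambda>(a, b). ys ! a \<bullet> ys ! b)"
  have A: "A \<in> carrier_mat n n"
    by (simp add: A_def)
  have "Determinant.det A \<noteq> 0"
  proof
    assume "Determinant.det A = 0"
    then obtain v where v: "v \<in> carrier_vec n" "v \<noteq> 0\<^sub>v n" "A *\<^sub>v v = 0\<^sub>v n"
      using det_0_iff_vec_prod_zero[OF A] by auto
    let ?y = "\<Sum>k<n. vec_index v k *\<^sub>R ys ! k"
    have "ys ! i \<bullet> ?y = 0" if "i < n" for i
    proof -
      have "vec_index (A *\<^sub>v v) i = (\<Sum>k<n. (ys ! i \<bullet> ys ! k) * vec_index v k)"
        using v(1) that by (auto simp: A_def scalar_prod_def lessThan_atLeast0)
      then show ?thesis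
        using v(3) that by (simp add: inner_sum_right mult.commute)
    qed
    then have "?y \<bullet> ?y = 0"
      by (subst inner_sum_left) auto
    then have "?y = 0" by simp
    then have "\<forall>k<n. vec_index v k = 0"
      using indep[of "vec_index v"] by (simp add: n_def)
    then have "v = 0\<^sub>v n"
      using v(1) by (intro eq_vecI) auto
    then show False using v(2) by simp
  qed
  then have "A \<in> Units (ring_mat TYPE(real) n ())"
    by (rule det_non_zero_imp_unit[OF A])
  then obtain B where B: "mat_inverse A = Some B"
    using mat_inverse(1)[OF A, where b = "()"] by (cases "mat_inverse A") auto
  then have AB: "A * B = 1\<^sub>m n" "B \<in> carrier_mat n n"
    using mat_inverse(2)[OF A B] by auto
  have gi: "gram_inv ys = B"
    using B by (simp add: gram_inv_def A_def n_def)
  have "(A * B) $$ (a, b) = (\<Sum>k<n. (ys ! a \<bullet> ys ! k) * B $$ (k, b))"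
    using AB(2) assms(2,3)
    by (auto simp: A_def scalar_prod_def n_def lessThan_atLeast0)
  then show ?thesis
    using AB(1) assms(2,3) by (simp add: gi n_def)
qed

lemma anderson_mat_mult:
  fixes ys :: "(real^'n) list"
  shows "anderson_mat \<beta> ss ys *v f = - \<beta> *\<^sub>R f +
    (\<Sum>a<length ys. (\<Sum>b<length ys. gram_inv ys $$ (a, b) * (ys ! b \<bullet> f)) *\<^sub>R
       (ss ! a + \<beta> *\<^sub>R ys ! a))"
proof -
  have 1: "(- \<beta> *\<^sub>R mat 1 :: real^'n^'n) *v f = - \<beta> *\<^sub>R f"
    by (metis matrix_vector_mul_lid scaleR_matrix_vector_assoc)
  have swap: "(\<Sum>q\<in>UNIV. \<Sum>a<length ys. \<Sum>b<length ys. h q a b)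
      = (\<Sum>a<length ys. \<Sum>b<length ys. \<Sum>q\<in>UNIV. h q a b)"
    for h :: "'n \<Rightarrow> nat \<Rightarrow> nat \<Rightarrow> real"
    by (rule trans, rule sum.swap, rule sum.cong[OF refl], rule sum.swap)
  show ?thesis
    unfolding anderson_mat_def matrix_vector_mult_add_rdistrib 1
    by (simp add: Finite_Cartesian_Product.vec_eq_iff matrix_vector_mult_def inner_vec_def
        sum_distrib_left sum_distrib_right swap mult_ac)
qed

text \<open>
  The witness is \<open>c = (Y\<^sup>T Y)\<^sup>-\<^sup>1 Y\<^sup>T f\<close>, reindexed from positions in the list to the indices themselves,
  and the second conjunct states its normal equations.
\<close>

lemma anderson_mat_least_squares:
  fixes ds df :: "'k \<Rightarrow> real^'n"
  assumes "distinct ks"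
    and indep: "\<And>c. (\<Sum>k\<in>set ks. c k *\<^sub>R df k) = 0 \<Longrightarrow> \<forall>k\<in>set ks. c k = 0"
  shows "\<exists>c.
    anderson_mat \<beta> (map ds ks) (map df ks) *v f =
      - \<beta> *\<^sub>R f + (\<Sum>k\<in>set ks. c k *\<^sub>R (ds k + \<beta> *\<^sub>R df k)) \<and>
    (\<forall>i\<in>set ks. df i \<bullet> (f - (\<Sum>k\<in>set ks. c k *\<^sub>R df k)) = 0)"
proof -
  let ?n = "length ks" and ?ys = "map df ks"
  have bij: "bij_betw ((!) ks) {..<?n} (set ks)"
    using assms(1) by (rule bij_betw_nth) auto
  define pos where "pos = the_inv_into {..<?n} ((!) ks)"
  have pos: "pos (ks ! a) = a" if "a < ?n" for a
    unfolding pos_def using bij that by (intro the_inv_into_f_f) (auto simp: bij_betw_def)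
  define g where "g a = (\<Sum>b<?n. gram_inv ?ys $$ (a, b) * (df (ks ! b) \<bullet> f))" for a
  define c where "c k = g (pos k)" for k
  have to_set: "(\<Sum>a<?n. h a *\<^sub>R v (ks ! a)) = (\<Sum>k\<in>set ks. h (pos k) *\<^sub>R v k)"
    for h and v :: "'k \<Rightarrow> real^'n"
    by (subst sum.reindex_bij_betw[OF bij, symmetric]) (auto simp: pos)
  have indep': "\<forall>a<length ?ys. h a = 0" if "(\<Sum>a<length ?ys. h a *\<^sub>R ?ys ! a) = 0" for h
  proof -
    have "(\<Sum>k\<in>set ks. h (pos k) *\<^sub>R df k) = 0"
      using that to_set[of h df] by simp
    then show ?thesis
      using indep[of "h \<circ> pos"] by (auto simp: pos dest: bspec[OF _ nth_mem])
  qed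
  have "anderson_mat \<beta> (map ds ks) ?ys *v f =
      - \<beta> *\<^sub>R f + (\<Sum>a<?n. g a *\<^sub>R (ds (ks ! a) + \<beta> *\<^sub>R df (ks ! a)))"
    by (simp add: anderson_mat_mult g_def)
  also have "\<dots> = - \<beta> *\<^sub>R f + (\<Sum>k\<in>set ks. c k *\<^sub>R (ds k + \<beta> *\<^sub>R df k))"
    unfolding c_def using to_set[of g "\<lambda>k. ds k + \<beta> *\<^sub>R df k"] by simp
  finally have eq: "anderson_mat \<beta> (map ds ks) ?ys *v f =
      - \<beta> *\<^sub>R f + (\<Sum>k\<in>set ks. c k *\<^sub>R (ds k + \<beta> *\<^sub>R df k))" .
  have "df i \<bullet> (f - (\<Sum>k\<in>set ks. c k *\<^sub>R df k)) = 0" if i: "i \<in> set ks" for i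
  proof -
    obtain a where a: "a < ?n" "i = ks ! a"
      using i by (auto simp: in_set_conv_nth)
    have "df i \<bullet> (\<Sum>k\<in>set ks. c k *\<^sub>R df k) = (\<Sum>k<?n. (df i \<bullet> df (ks ! k)) * g k)"
      unfolding c_def using to_set[of g df]
      by (metis (no_types, lifting) inner_scaleR_right inner_sum_right mult.commute sum.cong)
    also have "\<dots> = (\<Sum>b<?n. (\<Sum>k<?n. (df i \<bullet> df (ks ! k)) * gram_inv ?ys $$ (k, b)) * (df (ks ! b) \<bullet> f))"
      unfolding g_def sum_distrib_left sum_distrib_right
      by (subst sum.swap) (simp add: mult.assoc)
    also have "\<dots> = (\<Sum>b<?n. (if a = b then 1 else 0) * (df (ks ! b) \<bullet> f))"
      using gram_inv_right_inverse[of ?ys a, OF indep'] a by (auto intro!: sum.cong)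
    also have "\<dots> = (\<Sum>b<?n. if a = b then df (ks ! b) \<bullet> f else 0)"
      by (intro sum.cong) auto
    also have "\<dots> = df i \<bullet> f"
      using a by simp
    finally show ?thesis
      by (simp add: inner_diff_right)
  qed
  with eq show ?thesis by blast
qed


section \<open>Linearization errors\<close>

text \<open>
  The open set \<open>E\<close> contains a point other than \<open>sstar\<close>, where \<open>L\<close> times a positive distance bounds a
  norm.
\<close>

lemma newton_assumption_lipschitz_nonneg:
  assumes "newton_assumption F E sstar L"
  shows "0 \<le> L"
proof -
  have "E \<noteq> {sstar}"
    using assms not_open_singleton[of sstar] by (auto simp: newton_assumption_def)
  then obtain x where x: "x \<in> E" "x \<noteq> sstar"
    using assms by (auto simp: newton_assumption_def)
  have "0 \<le> opnorm (jac F x - jac F sstar)"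
    by (simp add: onorm_pos_le matrix_vector_mul_bounded_linear)
  also have "\<dots> \<le> L * norm (x - sstar)"
    using assms x by (auto simp: newton_assumption_def)
  finally show ?thesis
    using x by (simp add: zero_le_mult_iff)
qed

text \<open>
  The mean value inequality for \<open>x \<mapsto> F x - J x\<close> on the part of \<open>E\<close> in the ball around \<open>sstar\<close> that
  reaches to the farther of \<open>u\<close> and \<open>v\<close>; this set is convex and contains both points.
\<close>

lemma newton_linearization_bound:
  assumes A: "newton_assumption F E sstar L" and uv: "u \<in> E" "v \<in> E"
  shows "norm (F u - F v - jac F sstar *v (u - v))
    \<le> L * norm (u - v) * max (norm (u - sstar)) (norm (v - sstar))"
proof -
  define M where "M = max (norm (u - sstar)) (norm (v - sstar))"
  define S where "S = E \<inter> cball sstar M"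
  let ?J = "jac F sstar"
  have "convex S"
    unfolding S_def using A by (intro convex_Int) (auto simp: newton_assumption_def)
  have deriv: "((\<lambda>x. F x - ?J *v x) has_derivative (\<lambda>h. (jac F x - ?J) *v h)) (at x within S)"
    if "x \<in> S" for x
  proof -
    have "(F has_derivative (\<lambda>h. jac F x *v h)) (at x)"
      using A that by (auto simp: newton_assumption_def S_def jacobian_works[symmetric])
    then have "(F has_derivative (\<lambda>h. jac F x *v h)) (at x within S)"
      by (rule has_derivative_at_withinI)
    moreover have "((\<lambda>x. ?J *v x) has_derivative (\<lambda>h. ?J *v h)) (at x within S)"
      by (intro bounded_linear_imp_has_derivative matrix_vector_mul_bounded_linear)
    ultimately show ?thesis
      unfolding matrix_vector_mult_diff_rdistrib by (rule has_derivative_diff)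
  qed
  have bound: "opnorm (jac F x - ?J) \<le> L * M" if "x \<in> S" for x
  proof -
    have "opnorm (jac F x - ?J) \<le> L * norm (x - sstar)"
      using A that by (auto simp: newton_assumption_def S_def)
    also have "\<dots> \<le> L * M"
      using that newton_assumption_lipschitz_nonneg[OF A]
      by (intro mult_left_mono) (auto simp: S_def dist_norm norm_minus_commute)
    finally show ?thesis .
  qed
  have "u \<in> S" "v \<in> S"
    using uv by (auto simp: S_def M_def dist_norm norm_minus_commute)
  then have "norm ((F u - ?J *v u) - (F v - ?J *v v)) \<le> L * M * norm (u - v)"
    by (intro differentiable_bound[OF \<open>convex S\<close> deriv bound])
  then show ?thesis
    by (simp add: M_def matrix_vector_mult_diff_distrib algebra_simps)
qed

text \<open>
  Multiplied by the inverse of the Jacobian, the linearization error measures how far that inverse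
  is from satisfying the secant equation. The case \<open>v = sstar\<close> controls a Newton step, and
  successive iterates give the columns of \<open>S - J\<^sup>-\<^sup>1 Y\<close>.
\<close>

lemma inverse_linearization_bound:
  assumes A: "newton_assumption F E sstar L" and uv: "u \<in> E" "v \<in> E"
    and r: "norm (u - sstar) \<le> r" "norm (v - sstar) \<le> r"
  shows "norm ((u - v) - matrix_inv (jac F sstar) *v (F u - F v))
    \<le> opnorm (matrix_inv (jac F sstar)) * L * r * norm (u - v)"
proof -
  let ?J = "jac F sstar" and ?K = "matrix_inv (jac F sstar)"
  let ?w = "F u - F v - ?J *v (u - v)"
  have "?K ** ?J = mat 1"
    using A someI_ex[of "\<lambda>B. ?J ** B = mat 1 \<and> B ** ?J = mat 1"]
    by (simp add: newton_assumption_def invertible_def matrix_inv_def)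
  then have "(u - v) - ?K *v (F u - F v) = - (?K *v ?w)"
    by (simp add: matrix_vector_mult_diff_distrib matrix_vector_mul_assoc)
  then have "norm ((u - v) - ?K *v (F u - F v)) = norm (?K *v ?w)"
    by simp
  also have "\<dots> \<le> opnorm ?K * norm ?w"
    by (intro onorm matrix_vector_mul_bounded_linear)
  also have "\<dots> \<le> opnorm ?K * (L * norm (u - v) * r)"
  proof (intro mult_left_mono)
    have "norm ?w \<le> L * norm (u - v) * max (norm (u - sstar)) (norm (v - sstar))"
      by (rule newton_linearization_bound[OF A uv])
    also have "\<dots> \<le> L * norm (u - v) * r"
      using r newton_assumption_lipschitz_nonneg[OF A] by (intro mult_left_mono) auto
    finally show "norm ?w \<le> L * norm (u - v) * r" .
  qed (simp add: onorm_pos_le matrix_vector_mul_bounded_linear)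
  finally show ?thesis
    by (simp add: mult_ac)
qed

section \<open>Contraction of the iteration\<close>

lemma norm_diff_le_if_orthogonal:
  fixes x y :: "'a::real_inner"
  assumes "y \<bullet> (x - y) = 0"
  shows "norm (x - y) \<le> norm x"
proof -
  have "(norm x)\<^sup>2 = (norm (x - y))\<^sup>2 + (norm y)\<^sup>2"
    using assms by (simp add: power2_norm_eq_inner inner_diff_left inner_diff_right inner_commute)
  then show ?thesis
    by (simp add: norm_le_square power2_norm_eq_inner)
qed

text \<open>
  The three summands of the step in \<open>decomposition\<close> below are the Newton error, the part of \<open>f\<close>
  outside the span of the columns, on which the matrix acts as \<open>-\<beta> I\<close> in place of \<open>K\<close>, and the
  secant errors of the history, weighted by the least squares coefficients.
\<close>

lemma anderson_step_contraction:
  fixes F :: "real^'n \<Rightarrow> real^'n" and sstar :: "real^'n"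
  defines "K \<equiv> matrix_inv (jac F sstar)"
  assumes A: "newton_assumption F E sstar L" and B: "local_bilipschitz F E sstar \<kappa> \<rho>"
    and "1 < \<tau>" and "r \<le> \<kappa>"
    and \<delta>: "opnorm (- \<beta> *\<^sub>R mat 1 - K) \<le> \<delta>"
    and near: "\<And>i. i \<le> j \<Longrightarrow> norm (s i - sstar) \<le> r"
  shows "norm (anderson_step F m \<beta> \<tau> j s - sstar)
    \<le> (opnorm K * L * r + (\<delta> + opnorm K * L * \<rho> * (1 + \<tau>) ^ m * r) * \<rho>) * norm (s j - sstar)"
proof -
  define ds where "ds i = s (Suc i) - s i" for i
  define df where "df i = F (s (Suc i)) - F (s i)" for i
  define I where "I = selected \<tau> m df j"
  define f where "f = F (s j)"
  define D where "D = (- \<beta> *\<^sub>R mat 1 - K :: real^'n^'n)"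
  let ?ks = "sorted_list_of_set I"
  have fin: "finite I" and Ij: "i \<in> I \<Longrightarrow> i < j" for i
    by (auto simp: I_def selected_def)
  have ball: "s i \<in> cball sstar \<kappa>" and E: "s i \<in> E" if "i \<le> j" for i
    using near[OF that] \<open>r \<le> \<kappa>\<close> B
    by (auto simp: dist_norm norm_minus_commute local_bilipschitz_def subset_iff)
  have \<rho>: "0 < \<rho>" and \<kappa>: "sstar \<in> cball sstar \<kappa>" and L: "0 \<le> L" and r: "0 \<le> r"
    using B newton_assumption_lipschitz_nonneg[OF A] near[of 0] norm_ge_zero[of "s 0 - sstar"]
    by (auto simp: local_bilipschitz_def simp del: norm_ge_zero)
  have K0: "0 \<le> opnorm K"
    by (simp add: onorm_pos_le matrix_vector_mul_bounded_linear)
  have root: "F sstar = 0" "sstar \<in> E"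
    using A by (auto simp: newton_assumption_def)
  have f_le: "norm f \<le> \<rho> * norm (s j - sstar)"
  proof -
    have "norm (F (s j) - F sstar) \<le> \<rho> * norm (s j - sstar)"
      using B ball[of j] \<kappa> unfolding local_bilipschitz_def by blast
    then show ?thesis by (simp add: f_def root)
  qed
  have set_ks: "set ?ks = I"
    using fin by simp
  have "\<forall>k\<in>I. c k = 0" if "(\<Sum>k\<in>I. c k *\<^sub>R df k) = 0" for c
    using selected_independent[OF \<open>1 < \<tau>\<close> I_def that] by blast
  then obtain c where
    Hf: "anderson_mat \<beta> (map ds ?ks) (map df ?ks) *v f =
       - \<beta> *\<^sub>R f + (\<Sum>k\<in>I. c k *\<^sub>R (ds k + \<beta> *\<^sub>R df k))"
    and orth: "\<And>i. i \<in> I \<Longrightarrow> df i \<bullet> (f - (\<Sum>k\<in>I. c k *\<^sub>R df k)) = 0"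
    using anderson_mat_least_squares[of ?ks df \<beta> ds f, unfolded set_ks,
        OF distinct_sorted_list_of_set] by blast
  define y where "y = (\<Sum>k\<in>I. c k *\<^sub>R df k)"
  have step: "anderson_step F m \<beta> \<tau> j s
      = s j - anderson_mat \<beta> (map ds ?ks) (map df ?ks) *v f"
    unfolding anderson_step_def Let_def f_def I_def df_def ds_def ..
  have D_mult: "D *v x = - \<beta> *\<^sub>R x - K *v x" for x
    unfolding D_def matrix_vector_mult_diff_rdistrib
    by (metis matrix_vector_mul_lid scaleR_matrix_vector_assoc)
  have Hf': "anderson_mat \<beta> (map ds ?ks) (map df ?ks) *v f
      = K *v f + D *v (f - y) + (\<Sum>k\<in>I. c k *\<^sub>R (ds k - K *v df k))"
    unfolding Hf
    by (simp add: D_mult y_def algebra_simps sum.distrib sum_subtractf scaleR_sum_right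
        sum_negf linear_sum[OF matrix_vector_mul_linear, of K])
  have decomposition: "anderson_step F m \<beta> \<tau> j s - sstar
      = ((s j - sstar) - K *v (F (s j) - F sstar)) - D *v (f - y)
        - (\<Sum>k\<in>I. c k *\<^sub>R (ds k - K *v df k))"
    unfolding step Hf' by (simp add: root f_def)
  have newton_part: "norm ((s j - sstar) - K *v (F (s j) - F sstar))
      \<le> opnorm K * L * r * norm (s j - sstar)"
    unfolding K_def using near[of j] E[of j] root r
    by (intro inverse_linearization_bound[OF A]) auto
  have "0 \<le> \<delta>"
    using \<delta> onorm_pos_le[OF matrix_vector_mul_bounded_linear[of "- \<beta> *\<^sub>R mat 1 - K"]] by linarith
  have damping_part: "norm (D *v (f - y)) \<le> \<delta> * norm f"
  proof -
    have "y \<bullet> (f - y) = 0"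
      using orth unfolding y_def by (subst inner_sum_left) auto
    then have "norm (f - y) \<le> norm f"
      by (rule norm_diff_le_if_orthogonal)
    have "norm (D *v (f - y)) \<le> opnorm D * norm (f - y)"
      by (intro onorm matrix_vector_mul_bounded_linear)
    also have "\<dots> \<le> \<delta> * norm f"
      using \<open>norm (f - y) \<le> norm f\<close> \<delta> \<open>0 \<le> \<delta>\<close> unfolding D_def
      by (intro mult_mono) auto
    finally show ?thesis .
  qed
  have secant: "norm (ds k - K *v df k) \<le> opnorm K * L * \<rho> * r * norm (df k)" if "k \<in> I" for k
  proof -
    have k: "k \<le> j" "Suc k \<le> j"
      using Ij[OF that] by auto
    have "1 / \<rho> * norm (ds k) \<le> norm (df k)"
      using B ball[OF k(1)] ball[OF k(2)] unfolding local_bilipschitz_def ds_def df_def by blast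
    then have "norm (ds k) \<le> \<rho> * norm (df k)"
      using \<rho> by (simp add: field_simps)
    moreover have "norm (ds k - K *v df k) \<le> opnorm K * L * r * norm (ds k)"
      unfolding K_def ds_def df_def using near k E by (intro inverse_linearization_bound[OF A]) auto
    moreover have "0 \<le> opnorm K * L * r"
      using K0 L r by simp
    ultimately have "norm (ds k - K *v df k) \<le> opnorm K * L * r * (\<rho> * norm (df k))"
      by (meson mult_left_mono order_trans)
    then show ?thesis by (simp add: mult_ac)
  qed
  have history_part: "norm (\<Sum>k\<in>I. c k *\<^sub>R (ds k - K *v df k))
      \<le> opnorm K * L * \<rho> * r * ((1 + \<tau>) ^ m * norm f)"
  proof -
    have "norm (\<Sum>k\<in>I. c k *\<^sub>R (ds k - K *v df k))
        \<le> (\<Sum>k\<in>I. \<bar>c k\<bar> * (opnorm K * L * \<rho> * r * norm (df k)))"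
      using secant by (intro sum_norm_le) (auto intro: mult_left_mono)
    also have "\<dots> = opnorm K * L * \<rho> * r * (\<Sum>k\<in>I. \<bar>c k\<bar> * norm (df k))"
      by (simp add: sum_distrib_left mult_ac)
    also have "\<dots> \<le> opnorm K * L * \<rho> * r * ((1 + \<tau>) ^ m * norm f)"
      using K0 L r \<rho> selected_coefficients_bound[OF \<open>1 < \<tau>\<close> I_def orth]
      by (intro mult_left_mono) auto
    finally show ?thesis .
  qed
  have coeff: "0 \<le> \<delta> + opnorm K * L * \<rho> * (1 + \<tau>) ^ m * r"
    using \<open>0 \<le> \<delta>\<close> K0 L r \<rho> \<open>1 < \<tau>\<close> by auto
  have "norm (anderson_step F m \<beta> \<tau> j s - sstar)
      \<le> opnorm K * L * r * norm (s j - sstar) + \<delta> * norm f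
        + opnorm K * L * \<rho> * r * ((1 + \<tau>) ^ m * norm f)"
    unfolding decomposition
    by (rule norm_triangle_le_diff, rule add_mono[OF _ history_part], rule norm_triangle_le_diff,
        rule add_mono[OF newton_part damping_part])
  also have "\<dots> = opnorm K * L * r * norm (s j - sstar)
      + (\<delta> + opnorm K * L * \<rho> * (1 + \<tau>) ^ m * r) * norm f"
    by (simp add: algebra_simps)
  also have "\<dots> \<le> opnorm K * L * r * norm (s j - sstar)
      + (\<delta> + opnorm K * L * \<rho> * (1 + \<tau>) ^ m * r) * (\<rho> * norm (s j - sstar))"
    using coeff f_le by (intro add_left_mono mult_left_mono)
  finally show ?thesis
    by (simp add: algebra_simps)
qed

text \<open>
  The initial step is the Anderson step with an empty history.
\<close>

lemma stabilized_anderson_Suc: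
  assumes "stabilized_anderson F m \<beta> \<tau> s0 s"
  shows "s (Suc j) = anderson_step F m \<beta> \<tau> j s"
proof (cases j)
  case 0
  have "selected \<tau> m df 0 = {}" for df :: "nat \<Rightarrow> real^'a"
    by (simp add: selected_def)
  then show ?thesis
    using assms 0
    by (simp add: stabilized_anderson_def anderson_step_def Let_def anderson_mat_mult)
qed (use assms in \<open>simp add: stabilized_anderson_def\<close>)

lemma stabilized_anderson_contraction:
  fixes F :: "real^'n \<Rightarrow> real^'n" and sstar :: "real^'n"
  defines "K \<equiv> matrix_inv (jac F sstar)"
  assumes A: "newton_assumption F E sstar L" and B: "local_bilipschitz F E sstar \<kappa> \<rho>"
    and "1 < \<tau>" and "r \<le> \<kappa>" and "q < 1"
    and rate: "opnorm K * L * r + (\<delta> + opnorm K * L * \<rho> * (1 + \<tau>) ^ m * r) * \<rho> \<le> q"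
    and \<delta>: "opnorm (- \<beta> *\<^sub>R mat 1 - K) \<le> \<delta>"
    and s: "stabilized_anderson F m \<beta> \<tau> s0 s" and s0: "norm (s0 - sstar) \<le> r"
  shows "s (Suc j) \<in> E \<and> norm (s (Suc j) - sstar) \<le> q * norm (s j - sstar)"
proof -
  have contract: "norm (s (Suc j) - sstar) \<le> q * norm (s j - sstar)"
    if "\<And>i. i \<le> j \<Longrightarrow> norm (s i - sstar) \<le> r" for j
    using anderson_step_contraction[OF A B \<open>1 < \<tau>\<close> \<open>r \<le> \<kappa>\<close> \<delta>[unfolded K_def], of j s m, OF that]
      mult_right_mono[OF rate, of "norm (s j - sstar)"]
    unfolding stabilized_anderson_Suc[OF s] K_def by simp
  have near: "norm (s j - sstar) \<le> r" for j
  proof (induction j rule: less_induct)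
    case (less j)
    show ?case
    proof (cases j)
      case 0
      then show ?thesis using s s0 by (simp add: stabilized_anderson_def)
    next
      case (Suc i)
      have "norm (s (Suc i) - sstar) \<le> q * norm (s i - sstar)"
        using less Suc by (intro contract) auto
      also have "\<dots> \<le> norm (s i - sstar)"
        using \<open>q < 1\<close> mult_right_mono[of q 1 "norm (s i - sstar)"] by simp
      finally show ?thesis
        using less[of i] Suc by simp
    qed
  qed
  have "s (Suc j) \<in> cball sstar \<kappa>"
    using near[of "Suc j"] \<open>r \<le> \<kappa>\<close> by (simp add: dist_norm norm_minus_commute)
  then show ?thesis
    using B contract near by (auto simp: local_bilipschitz_def)
qed

text \<open>
  The three terms of the contraction factor share \<open>q\<close>: the damping error gets \<open>q / 3\<close>, and the two
  terms proportional to \<open>r\<close> together another \<open>q / 3\<close>. The summand \<open>1\<close> keeps the denominator positive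
  when \<open>A\<close> and \<open>a\<close> vanish, as happens for \<open>L = 0\<close>.
\<close>

lemma contraction_radius:
  fixes A a q \<rho> \<kappa> :: real
  assumes "0 \<le> A" "0 \<le> a" "0 < q" "0 < \<rho>"
    and r: "r = min \<kappa> (q / (3 * (A + a * \<rho> + 1)))" and "0 < \<kappa>"
  shows "0 < r" and "r \<le> \<kappa>" and "A * r + (q / (3 * \<rho>) + a * r) * \<rho> \<le> q"
proof -
  define c where "c = A + a * \<rho> + 1"
  have "0 < c"
    using assms by (simp add: c_def add_nonneg_pos)
  then show "0 < r" "r \<le> \<kappa>"
    using assms by (auto simp: c_def)
  have "(A + a * \<rho>) * r \<le> c * r"
    using \<open>0 < r\<close> by (simp add: c_def algebra_simps)
  also have "\<dots> \<le> c * (q / (3 * c))"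
    using \<open>0 < c\<close> r by (intro mult_left_mono) (auto simp: c_def)
  also have "\<dots> = q / 3"
    using \<open>0 < c\<close> by simp
  finally have "(A + a * \<rho>) * r \<le> q / 3" .
  moreover have "A * r + (q / (3 * \<rho>) + a * r) * \<rho> = (A + a * \<rho>) * r + q / 3"
    using \<open>0 < \<rho>\<close> by (simp add: field_simps)
  ultimately show "A * r + (q / (3 * \<rho>) + a * r) * \<rho> \<le> q"
    using \<open>0 < q\<close> by linarith
qed

theorem theorem1:
  shows "\<exists>\<alpha> :: real \<Rightarrow> nat \<Rightarrow> real \<Rightarrow> real.
    \<forall>(G :: real^'n \<Rightarrow> real^'n) F E sstar L \<kappa> \<rho>.
      F = (\<lambda>s. G s - s) \<and> newton_assumption F E sstar L \<and> local_bilipschitz F E sstar \<kappa> \<rho> \<longrightarrow>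
      (\<exists>\<delta> \<epsilon> :: real \<Rightarrow> real \<Rightarrow> real.
        \<forall>m \<tau>. m \<ge> 1 \<and> \<tau> > 1 \<longrightarrow>
          (let Jinv = matrix_inv (jac F sstar);
               a = \<alpha> \<tau> m (opnorm Jinv * L * \<rho>)
           in \<forall>q. 0 < q \<and> q < 1 \<longrightarrow>
                \<delta> q a > 0 \<and> \<epsilon> q a > 0 \<and>
                (\<forall>\<beta> s0 s.
                   stabilized_anderson F m \<beta> \<tau> s0 s \<and>
                   opnorm (- \<beta> *\<^sub>R mat 1 - Jinv) \<le> \<delta> q a \<and> norm (s0 - sstar) \<le> \<epsilon> q a \<longrightarrow>
                   (\<forall>j. s (Suc j) \<in> E \<and>
                        norm (s (Suc j) - sstar) \<le> q * norm (s j - sstar)))))"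
proof (intro exI[of _ "\<lambda>\<tau> m C. C * (1 + \<tau>) ^ m"] allI impI, elim conjE, goal_cases)
  case (1 G F E sstar L \<kappa> \<rho>)
  note N = 1(2) and B = 1(3)
  define A where "A = opnorm (matrix_inv (jac F sstar)) * L"
  define \<delta> where "\<delta> q a = q / (3 * \<rho>)" for q a :: real
  define \<epsilon> where "\<epsilon> q a = min \<kappa> (q / (3 * (A + a * \<rho> + 1)))" for q a
  have pos: "0 < \<rho>" "0 < \<kappa>"
    using B by (auto simp: local_bilipschitz_def)
  have "0 \<le> A"
    unfolding A_def using newton_assumption_lipschitz_nonneg[OF N]
    by (simp add: onorm_pos_le matrix_vector_mul_bounded_linear)
  show ?case
    unfolding Let_def A_def[symmetric]
  proof (rule exI[of _ \<delta>], rule exI[of _ \<epsilon>], intro allI impI, elim conjE, goal_cases)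
    case (1 m \<tau> q)
    define a where "a = A * \<rho> * (1 + \<tau>) ^ m"
    have "0 \<le> a"
      using \<open>0 \<le> A\<close> pos \<open>1 < \<tau>\<close> by (simp add: a_def)
    note radius = contraction_radius[OF \<open>0 \<le> A\<close> \<open>0 \<le> a\<close> \<open>0 < q\<close> pos(1) \<epsilon>_def pos(2)]
    have rate: "A * \<epsilon> q a + (\<delta> q a + A * \<rho> * (1 + \<tau>) ^ m * \<epsilon> q a) * \<rho> \<le> q"
      using radius(3) by (simp add: \<delta>_def a_def)
    have "0 < \<delta> q a"
      using \<open>0 < q\<close> pos by (simp add: \<delta>_def)
    then show ?case
      unfolding a_def[symmetric]
      using radius(1) stabilized_anderson_contraction[OF N B \<open>1 < \<tau>\<close> radius(2) \<open>q < 1\<close>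
          rate[unfolded A_def]] by blast
  qed
qed

end
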